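(* There exists an $AP_{3}$-covering sequence $A \subseteq \mathbb{N}$ such that \[ \liminf_{n \rightarrow \infty}\frac{A(n)}{\sqrt{n}} \le 2. \]
   Context: $\mathbb{N}$ denotes the set of all nonnegative integers. For an integer $k\ge 3$, a set (sequence) $A \subseteq \mathbb{N}$ is called an $AP_{k}$-covering sequence if there exists an integer $n_{0}$ such that for every integer $n > n_{0}$ there exist $a_{1}, \dots, a_{k-1} \in A$ with $a_{1} < \cdots < a_{k-1} < n$ such that $a_{1}, \dots, a_{k-1}, n$ form a $k$-term arithmetic progression. For $A\subseteq \mathbb{N}$, $A(n)$ denotes the number of elements of $A$ up to $n$, i.e. $A(n) = |\{a \in A : a \le n\}|$. *)

theory Defs
  imports "HOL-Analysis.Analysis"
begin

definition arith_prog :: "nat list \<Rightarrow> bool" where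
  "arith_prog xs \<longleftrightarrow>
     (\<exists>d::int. \<forall>i. Suc i < length xs \<longrightarrow> int (xs ! Suc i) = int (xs ! i) + d)"

(* Meaningful for k \<ge> 3. The list as is [a_1, ..., a_{k-1}]. *)
definition AP_covering :: "nat \<Rightarrow> nat set \<Rightarrow> bool" where
  "AP_covering k A \<longleftrightarrow>
     (\<exists>n0. \<forall>n>n0. \<exists>as. length as = k - 1 \<and> set as \<subseteq> A \<and>
        sorted_wrt (<) (as @ [n]) \<and> arith_prog (as @ [n]))"

definition counting :: "nat set \<Rightarrow> nat \<Rightarrow> nat" where
  "counting A n = card {a \<in> A. a \<le> n}"

end

theory Submission
  imports Defs
begin

text \<open>
  A block of \<open>2t\<close> consecutive integers starting at \<open>c\<close>, together with the multiples
  \<open>t, 2t, 3t, \<dots>\<close> of \<open>t\<close>, covers a long interval: every \<open>n\<close> is \<open>2tj - b\<close> for some \<open>j\<close>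
  and some \<open>b\<close> in the block, because the block meets every residue class modulo \<open>2t\<close>.
  The multiples up to \<open>t (2t + 2)\<close> suffice to reach \<open>N = 4t\<^sup>2\<close>, so about
  \<open>4t = 2 sqrt N\<close> elements cover \<open>[c + 2, N + 2]\<close> (lemma \<open>stage_covers\<close>).

  Such stages are concatenated, the next one starting at \<open>c' = N + 1\<close>. Choosing
  \<open>t = c\<^sup>2\<close>, the elements of the earlier stages, of which there are at most \<open>c\<close>, are
  negligible compared with \<open>t\<close>, while those of the later stages exceed \<open>N\<close>. Hence the union
  has at most \<open>4t + o(t)\<close> elements up to \<open>N\<close> (lemma \<open>counting_stages\<close>), which
  bounds the lower limit by \<open>2\<close> along the sequence of these \<open>N\<close>.
\<close>

text \<open>The stage starting at \<open>c\<close>, with \<open>t = c\<^sup>2\<close>.\<close>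

definition stage :: "nat \<Rightarrow> nat set" where
  "stage c = {c..<c + 2 * c\<^sup>2} \<union> (\<lambda>j. c\<^sup>2 * j) ` {1..2 * c\<^sup>2 + 2}"

text \<open>The starting points of the successive stages: the stage starting at \<open>c\<close> lies
  below \<open>N = 4t\<^sup>2 = 4c\<^sup>4\<close>, inclusive, and the next one starts at \<open>N + 1\<close>.\<close>

primrec start :: "nat \<Rightarrow> nat" where
  "start 0 = 1"
| "start (Suc i) = 4 * (start i) ^ 4 + 1"

text \<open>The covering sequence.\<close>

definition stages :: "nat set" where
  "stages = (\<Union>i. stage (start i))"

lemma start_pos: "start i \<ge> 1"
  by (cases i) auto

lemma start_less_Suc: "start i < start (Suc i)"
proof -
  have "start i ^ 1 \<le> start i ^ 4"
    using start_pos[of i] by (intro power_increasing) auto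
  then show ?thesis
    by simp
qed

lemma strict_mono_start: "strict_mono start"
  unfolding strict_mono_Suc_iff using start_less_Suc by blast

lemma le_square_nat: "c \<le> c\<^sup>2" for c :: nat
  by (simp add: power2_nat_le_imp_le)

lemma stage_ge:
  assumes "x \<in> stage c"
  shows "c \<le> x"
proof -
  have "c \<le> c\<^sup>2 * j" if "j \<ge> 1" for j
    using mult_le_mono[OF le_square_nat[of c] that] by simp
  then show ?thesis
    using assms unfolding stage_def by auto
qed

lemma stage_le:
  assumes "x \<in> stage c" and "c \<ge> 1"
  shows "x \<le> 4 * c ^ 4"
proof -
  define t where "t = c\<^sup>2"
  have t: "c \<le> t" "1 \<le> t" "4 * c ^ 4 = 4 * (t * t)"
    using le_square_nat[of c] assms(2) unfolding t_def by (auto simp flip: power_add power2_eq_square)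
  have tt: "t \<le> t * t"
    by simp
  from assms(1) consider "x < c + 2 * t" | j where "x = t * j" "j \<le> 2 * t + 2"
    unfolding stage_def t_def by fastforce
  then have "x \<le> 4 * (t * t)"
  proof cases
    case 1
    then show ?thesis
      using t tt by linarith
  next
    case 2
    then have "x \<le> t * (2 * t + 2)"
      by (simp only: mult_le_mono2)
    also have "\<dots> = 2 * (t * t) + 2 * t"
      by (simp add: algebra_simps)
    finally show ?thesis
      using tt by linarith
  qed
  then show ?thesis
    using t by simp
qed

lemma stage_covers:
  assumes c: "c \<ge> 1" and n: "c + 2 \<le> n" "n \<le> 4 * c ^ 4 + 2"
  obtains a b where "a \<in> stage c" "b \<in> stage c" "b < a" "a < n" "n + b = 2 * a"
proof -
  define t where "t = c\<^sup>2"
  have t: "c \<le> t" "1 \<le> t" "4 * c ^ 4 = 4 * (t * t)"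
    using le_square_nat[of c] c unfolding t_def by (auto simp flip: power_add power2_eq_square)
  have stage: "stage c = {c..<c + 2 * t} \<union> (\<lambda>j. t * j) ` {1..2 * t + 2}"
    unfolding stage_def t_def ..
  show ?thesis
  proof (cases "n \<le> c + 2 * t")
    case True
    have "n - 1 \<in> stage c" "n - 2 \<in> stage c"
      unfolding stage using True n by auto
    then show ?thesis
      using n by (intro that[of "n - 1" "n - 2"]) auto
  next
    case False
    \<comment> \<open>\<open>j\<close> is \<open>(n + c) / (2t)\<close> rounded up, so that \<open>2tj - n\<close> lies in the block.\<close>
    define q where "q = (n + c - 1) div (2 * t)"
    define j where "j = q + 1"
    have "2 * t * q + (n + c - 1) mod (2 * t) = n + c - 1"
      unfolding q_def by simp
    moreover have "(n + c - 1) mod (2 * t) < 2 * t"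
      using t by simp
    moreover have j_eq: "2 * t * j = 2 * t * q + 2 * t"
      unfolding j_def by simp
    ultimately have lo: "n + c \<le> 2 * t * j" and hi: "2 * t * j < n + c + 2 * t"
      using n by linarith+
    have "2 * t * q < 2 * t * (2 * t + 2)"
    proof -
      have "2 * t * (2 * t + 2) = 4 * (t * t) + 4 * t"
        by (simp add: algebra_simps)
      then show ?thesis
        using hi j_eq n t by linarith
    qed
    then have "q < 2 * t + 2"
      by (simp only: mult_less_cancel1)
    then have "j \<in> {1..2 * t + 2}"
      unfolding j_def by simp
    then have "t * j \<in> stage c"
      unfolding stage by blast
    moreover have "2 * t * j - n \<in> stage c"
      unfolding stage using lo hi by auto
    ultimately show ?thesis
      using lo hi False by (intro that[of "t * j" "2 * t * j - n"]) auto
  qed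
qed

lemma AP_covering_3I:
  assumes "\<And>n. n > n0 \<Longrightarrow> \<exists>a\<in>A. \<exists>b\<in>A. b < a \<and> a < n \<and> n + b = 2 * a"
  shows "AP_covering 3 A"
  unfolding AP_covering_def
proof (intro exI[of _ n0] allI impI)
  fix n
  assume "n0 < n"
  then obtain a b where ab: "a \<in> A" "b \<in> A" "b < a" "a < n" "n + b = 2 * a"
    using assms by blast
  have "arith_prog ([b, a] @ [n])"
    unfolding arith_prog_def
    using ab by (intro exI[of _ "int a - int b"]) (auto simp: less_Suc_eq)
  then show "\<exists>as. length as = 3 - 1 \<and> set as \<subseteq> A \<and>
      sorted_wrt (<) (as @ [n]) \<and> arith_prog (as @ [n])"
    using ab by (intro exI[of _ "[b, a]"]) auto
qed

lemma AP_covering_stages: "AP_covering 3 stages"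
proof (rule AP_covering_3I[of 2])
  fix n :: nat
  assume "n > 2"
  define P where "P = (\<lambda>i. n < start i + 2)"
  have "n \<le> start n"
    by (rule strict_mono_imp_increasing[OF strict_mono_start])
  then have "P n"
    unfolding P_def by simp
  moreover have "\<not> P 0"
    unfolding P_def using \<open>n > 2\<close> by simp
  ultimately obtain i where "\<not> P i" "P (Suc i)"
    using ex_least_nat_less[of P n] by blast
  then have "start i + 2 \<le> n" "n \<le> 4 * start i ^ 4 + 2"
    unfolding P_def by auto
  from stage_covers[OF start_pos this]
  show "\<exists>a\<in>stages. \<exists>b\<in>stages. b < a \<and> a < n \<and> n + b = 2 * a"
    unfolding stages_def by (metis UN_I UNIV_I)
qed

lemma card_stage_le: "card (stage c) \<le> 4 * c\<^sup>2 + 2"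
proof -
  have "card (stage c) \<le> card {c..<c + 2 * c\<^sup>2} + card ((\<lambda>j. c\<^sup>2 * j) ` {1..2 * c\<^sup>2 + 2})"
    unfolding stage_def by (rule card_Un_le)
  also have "card ((\<lambda>j. c\<^sup>2 * j) ` {1..2 * c\<^sup>2 + 2}) \<le> card {1..2 * c\<^sup>2 + 2}"
    by (rule card_image_le) simp
  finally show ?thesis
    by simp
qed

lemma counting_stages:
  "counting stages (4 * start i ^ 4) \<le> start i + (4 * (start i)\<^sup>2 + 2)"
proof -
  have "{a \<in> stages. a \<le> 4 * start i ^ 4} \<subseteq> {..<start i} \<union> stage (start i)"
  proof
    fix x
    assume "x \<in> {a \<in> stages. a \<le> 4 * start i ^ 4}"
    then obtain k where k: "x \<in> stage (start k)" and x: "x < start (Suc i)"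
      unfolding stages_def by auto
    consider "k < i" | "k = i" | "i < k"
      by linarith
    then show "x \<in> {..<start i} \<union> stage (start i)"
    proof cases
      case 1
      have "x < start (Suc k)"
        using stage_le[OF k start_pos] by simp
      also have "\<dots> \<le> start i"
        using 1 strict_mono_less_eq[OF strict_mono_start] by (simp del: start.simps)
      finally show ?thesis
        by simp
    next
      case 2
      then show ?thesis
        using k by simp
    next
      case 3
      then have "start (Suc i) \<le> start k"
        using strict_mono_less_eq[OF strict_mono_start] by (simp del: start.simps)
      then show ?thesis
        using stage_ge[OF k] x by linarith
    qed
  qed
  moreover have "finite (stage (start i))"
    unfolding stage_def by simp
  ultimately have "counting stages (4 * start i ^ 4) \<le> card ({..<start i} \<union> stage (start i))"
    unfolding counting_def by (intro card_mono) auto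
  also have "\<dots> \<le> card {..<start i} + card (stage (start i))"
    by (rule card_Un_le)
  finally show ?thesis
    using card_stage_le[of "start i"] by simp
qed

lemma counting_stages_ratio:
  "real (counting stages (4 * start i ^ 4)) / sqrt (real (4 * start i ^ 4))
    \<le> 2 + 3 / 2 * inverse (real (start i))"
proof -
  define c where "c = real (start i)"
  have c: "c \<ge> 1"
    unfolding c_def using start_pos[of i] by simp
  have "real (4 * start i ^ 4) = (2 * c\<^sup>2)\<^sup>2"
    unfolding c_def by (simp add: power2_eq_square power4_eq_xxxx)
  then have sqrt: "sqrt (real (4 * start i ^ 4)) = 2 * c\<^sup>2"
    by (simp only: real_sqrt_abs) simp
  have "real (counting stages (4 * start i ^ 4)) \<le> real (start i + (4 * (start i)\<^sup>2 + 2))"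
    using counting_stages by (simp only: of_nat_le_iff)
  also have "\<dots> = c + (4 * c\<^sup>2 + 2)"
    unfolding c_def by simp
  also have "\<dots> \<le> (2 + 3 / 2 * inverse c) * (2 * c\<^sup>2)"
    using c by (simp add: field_simps power2_eq_square)
  finally show ?thesis
    unfolding sqrt using c by (simp add: divide_le_eq c_def)
qed

theorem theorem1:
  "\<exists>A :: nat set. AP_covering 3 A \<and>
     liminf (\<lambda>n. ereal (real (counting A n) / sqrt (real n))) \<le> 2"
proof (intro exI[of _ stages] conjI AP_covering_stages)
  let ?X = "\<lambda>n. ereal (real (counting stages n) / sqrt (real n))"
  let ?r = "\<lambda>i. 4 * start i ^ 4"
  let ?Y = "\<lambda>i. ereal (2 + 3 / 2 * inverse (real (start i)))"
  \<comment> \<open>The lower limit is bounded along the sequence of the right ends of the stages.\<close>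
  have "strict_mono ?r"
    using strict_mono_less[OF strict_mono_start]
    by (intro strict_monoI) (simp add: power_strict_mono)
  then have "liminf ?X \<le> liminf (?X \<circ> ?r)"
    by (rule liminf_subseq_mono)
  also have "\<dots> \<le> liminf ?Y"
    unfolding o_def using counting_stages_ratio
    by (intro Liminf_mono always_eventually allI) (simp only: ereal_less_eq)
  also have "liminf ?Y = 2"
  proof (rule lim_imp_Liminf)
    have "filterlim (\<lambda>i. real (start i)) at_top sequentially"
      using filterlim_subseq[OF strict_mono_start]
      by (rule filterlim_compose[OF filterlim_real_sequentially])
    then have "(\<lambda>i. inverse (real (start i))) \<longlonglongrightarrow> 0"
      by (rule tendsto_inverse_0_at_top)
    then have "(\<lambda>i. 2 + 3 / 2 * inverse (real (start i))) \<longlonglongrightarrow> 2 + 3 / 2 * 0"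
      by (intro tendsto_intros)
    then have "?Y \<longlonglongrightarrow> ereal 2"
      by simp
    then show "?Y \<longlonglongrightarrow> 2"
      by simp
  qed simp
  finally show "liminf ?X \<le> 2" .
qed

end
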